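(* Suppose $\sigma\colon X\to E$ is an uncollapsed uniformly continuous map between Banach spaces $X$ and $E$. Then, for any $1\leqslant p<\infty$, there is a map $X\to \ell^p(E)$ that is simultaneously a uniform embedding and a coarse embedding.
   Context: For a map $\sigma\colon (X,d)\to (Y,\partial)$ between metric spaces put $\kappa_\sigma(t)=\inf\{\partial(\sigma(a),\sigma(b)) : d(a,b)\geqslant t\}$ (compression modulus) and $\theta_\sigma(t)=\sup\{\partial(\sigma(a),\sigma(b)) : d(a,b)\leqslant t\}$ (expansion modulus). The map $\sigma$ is uniformly continuous if $\lim_{t\to 0_+}\theta_\sigma(t)=0$; a uniform embedding if it is uniformly continuous and $\kappa_\sigma(t)>0$ for all $t>0$; bornologous if $\theta_\sigma(t)<\infty$ for all $t<\infty$; expanding if $\lim_{t\to\infty}\kappa_\sigma(t)=\infty$; a coarse embedding if it is bornologous and expanding; uncollapsed if $\kappa_\sigma(t)>0$ for some $t>0$. Banach spaces carry their norm metric. $\ell^p(E)$ is the Banach space of sequences $(\xi_n)_n$ in $E$ with $\|(\xi_n)\|=(\sum_n\|\xi_n\|^p)^{1/p}<\infty$. *)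

theory Defs
  imports "HOL-Analysis.Analysis"
begin

text \<open>
  The moduli take values in \<^typ>\<open>ennreal\<close>, so that the infimum over an empty set of pairs is
  \<open>\<infinity>\<close> and an unbounded supremum is \<open>\<infinity>\<close>. For negative \<open>t\<close>, which never matters, the expansion
  modulus is \<open>0\<close>.
\<close>

definition compression_modulus :: "'a metric \<Rightarrow> 'b metric \<Rightarrow> ('a \<Rightarrow> 'b) \<Rightarrow> real \<Rightarrow> ennreal" where
  "compression_modulus m1 m2 f t =
     Inf {ennreal (mdist m2 (f a) (f b)) | a b. a \<in> mspace m1 \<and> b \<in> mspace m1 \<and> mdist m1 a b \<ge> t}"

definition expansion_modulus :: "'a metric \<Rightarrow> 'b metric \<Rightarrow> ('a \<Rightarrow> 'b) \<Rightarrow> real \<Rightarrow> ennreal" where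
  "expansion_modulus m1 m2 f t =
     Sup {ennreal (mdist m2 (f a) (f b)) | a b. a \<in> mspace m1 \<and> b \<in> mspace m1 \<and> mdist m1 a b \<le> t}"

text \<open>
  Uniform continuity is the library notion \<^const>\<open>uniformly_continuous_map\<close>; it is equivalent to
  the expansion modulus tending to \<open>0\<close> at \<open>0\<close>.
\<close>

lemma uniformly_continuous_map_iff_expansion_modulus:
  "uniformly_continuous_map m1 m2 f \<longleftrightarrow>
     f \<in> mspace m1 \<rightarrow> mspace m2 \<and> (expansion_modulus m1 m2 f \<longlongrightarrow> 0) (at_right 0)"
  (is "?L \<longleftrightarrow> ?F \<and> ?R")
proof (intro iffI conjI)
  assume L: ?L
  then show ?F by (rule uniformly_continuous_map_funspace)
  show ?R
  proof (rule order_tendstoI)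
    fix e :: ennreal assume e: "0 < e"
    obtain r :: real where r: "0 < r" "ennreal r < e"
    proof -
      obtain q where q: "0 < q" "q < e" using dense[OF e] by blast
      then have "q = ennreal (enn2real q)"
        by (metis ennreal_enn2real less_top_ennreal not_less top.not_eq_extremum top_greatest less_trans)
      moreover have "0 < enn2real q" using q calculation
        by (metis ennreal_0 enn2real_nonneg order_le_less less_irrefl)
      ultimately show thesis using that q by metis
    qed
    from L r obtain d where d: "d > 0"
      "\<And>x y. x \<in> mspace m1 \<Longrightarrow> y \<in> mspace m1 \<Longrightarrow> mdist m1 y x < d \<Longrightarrow> mdist m2 (f y) (f x) < r"
      unfolding uniformly_continuous_map_def by metis
    have "expansion_modulus m1 m2 f t < e" if t: "t < d" for t
    proof -
      have "expansion_modulus m1 m2 f t \<le> ennreal r"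
        unfolding expansion_modulus_def
      proof (rule Sup_least, clarify)
        fix a b assume ab: "a \<in> mspace m1" "b \<in> mspace m1" "mdist m1 a b \<le> t"
        have "mdist m1 a b < d" using ab t by simp
        then have "mdist m2 (f a) (f b) < r" using d(2)[OF ab(2,1)] by simp
        then show "ennreal (mdist m2 (f a) (f b)) \<le> ennreal r" by (intro ennreal_leI) simp
      qed
      with r show ?thesis by simp
    qed
    then show "\<forall>\<^sub>F t in at_right 0. expansion_modulus m1 m2 f t < e"
      using d(1) by (auto simp: eventually_at_right_field)
  qed auto
next
  assume R: "?F \<and> ?R"
  show ?L
    unfolding uniformly_continuous_map_def
  proof (intro conjI allI impI)
    show ?F using R by simp
    fix e :: real assume e: "0 < e"
    then have "\<forall>\<^sub>F t in at_right 0. expansion_modulus m1 m2 f t < ennreal e"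
      using R by (intro order_tendstoD(2)) auto
    then obtain d where d: "d > 0" "\<And>t. 0 < t \<Longrightarrow> t < d \<Longrightarrow> expansion_modulus m1 m2 f t < ennreal e"
      by (auto simp: eventually_at_right_field)
    have "mdist m2 (f y) (f x) < e"
      if xy: "x \<in> mspace m1" "y \<in> mspace m1" "mdist m1 y x < d/2" for x y
    proof -
      have "ennreal (mdist m2 (f y) (f x)) \<le> expansion_modulus m1 m2 f (d/2)"
        unfolding expansion_modulus_def using xy by (intro Sup_upper) (auto intro: less_imp_le)
      also have "\<dots> < ennreal e" using d by simp
      finally show ?thesis by (simp add: ennreal_less_iff)
    qed
    then show "\<exists>\<delta>>0. \<forall>x\<in>mspace m1. \<forall>y\<in>mspace m1. mdist m1 y x < \<delta> \<longrightarrow> mdist m2 (f y) (f x) < e"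
      using d(1) by (intro exI[of _ "d/2"]) auto
  qed
qed

definition uniform_embedding :: "'a metric \<Rightarrow> 'b metric \<Rightarrow> ('a \<Rightarrow> 'b) \<Rightarrow> bool" where
  "uniform_embedding m1 m2 f \<longleftrightarrow>
     uniformly_continuous_map m1 m2 f \<and> (\<forall>t>0. compression_modulus m1 m2 f t > 0)"

definition bornologous :: "'a metric \<Rightarrow> 'b metric \<Rightarrow> ('a \<Rightarrow> 'b) \<Rightarrow> bool" where
  "bornologous m1 m2 f \<longleftrightarrow>
     f \<in> mspace m1 \<rightarrow> mspace m2 \<and> (\<forall>t. expansion_modulus m1 m2 f t < \<infinity>)"

definition expanding :: "'a metric \<Rightarrow> 'b metric \<Rightarrow> ('a \<Rightarrow> 'b) \<Rightarrow> bool" where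
  "expanding m1 m2 f \<longleftrightarrow>
     f \<in> mspace m1 \<rightarrow> mspace m2 \<and> (compression_modulus m1 m2 f \<longlongrightarrow> \<infinity>) at_top"

definition coarse_embedding :: "'a metric \<Rightarrow> 'b metric \<Rightarrow> ('a \<Rightarrow> 'b) \<Rightarrow> bool" where
  "coarse_embedding m1 m2 f \<longleftrightarrow> bornologous m1 m2 f \<and> expanding m1 m2 f"

definition uncollapsed :: "'a metric \<Rightarrow> 'b metric \<Rightarrow> ('a \<Rightarrow> 'b) \<Rightarrow> bool" where
  "uncollapsed m1 m2 f \<longleftrightarrow>
     f \<in> mspace m1 \<rightarrow> mspace m2 \<and> (\<exists>t>0. compression_modulus m1 m2 f t > 0)"

text \<open>
  The exponent \<open>p\<close> is a real parameter, so \<open>\<ell>\<^sup>p(E)\<close> is a set of sequences with a norm rather than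
  a type. Note that \<open>0 powr p = 0\<close>.
\<close>

definition lp_space :: "real \<Rightarrow> (nat \<Rightarrow> 'e::real_normed_vector) set" where
  "lp_space p = {\<xi>. summable (\<lambda>n. norm (\<xi> n) powr p)}"

definition lp_norm :: "real \<Rightarrow> (nat \<Rightarrow> 'e::real_normed_vector) \<Rightarrow> real" where
  "lp_norm p \<xi> = (\<Sum>n. norm (\<xi> n) powr p) powr (1 / p)"

definition lp_dist :: "real \<Rightarrow> (nat \<Rightarrow> 'e::real_normed_vector) \<Rightarrow> (nat \<Rightarrow> 'e) \<Rightarrow> real" where
  "lp_dist p \<xi> \<eta> = lp_norm p (\<lambda>n. \<xi> n - \<eta> n)"

text \<open>
  For \<open>1 \<le> p\<close> the simplification rules \<open>mspace_lp_metric\<close> and \<open>mdist_lp_metric\<close> below recover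
  the carrier and the distance.
\<close>

definition lp_metric :: "real \<Rightarrow> (nat \<Rightarrow> 'e::real_normed_vector) metric" where
  "lp_metric p = metric (lp_space p, lp_dist p)"

lemma powr_convex_nonneg:
  fixes u v s p :: real
  assumes "1 \<le> p" "0 \<le> u" "0 \<le> v" "0 \<le> s" "s \<le> 1"
  shows "((1 - s) * u + s * v) powr p \<le> (1 - s) * u powr p + s * v powr p"
proof -
  have scale: "(r * w) powr p \<le> r * w powr p" if "0 \<le> r" "r \<le> 1" "0 \<le> w" for r w :: real
  proof -
    have "r powr p \<le> r powr 1" if "r \<noteq> 0"
      using that \<open>0 \<le> r\<close> \<open>r \<le> 1\<close> assms(1) by (intro powr_mono') auto
    then have "r powr p \<le> r" using that by (cases "r = 0") auto
    then show ?thesis using that by (simp add: powr_mult mult_right_mono)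
  qed
  consider "u = 0" | "v = 0" | "0 < u" "0 < v" using assms by linarith
  then show ?thesis
  proof cases
    case 1 then show ?thesis using scale[of s v] assms by simp
  next
    case 2 then show ?thesis using scale[of "1 - s" u] assms by simp
  next
    case 3 then show ?thesis
      using convex_onD[OF powr_convex[OF assms(1)], of s u v] assms by simp
  qed
qed

lemma lp_norm_nonneg: "0 \<le> lp_norm p \<xi>"
  by (simp add: lp_norm_def)

lemma lp_norm_powr:
  assumes "1 \<le> p" "\<xi> \<in> lp_space p"
  shows "lp_norm p \<xi> powr p = (\<Sum>n. norm (\<xi> n) powr p)"
proof -
  have "0 \<le> (\<Sum>n. norm (\<xi> n) powr p)"
    using assms by (intro suminf_nonneg) (auto simp: lp_space_def)
  then show ?thesis using assms by (simp add: lp_norm_def powr_powr)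
qed

lemma lp_norm_eq_0_iff:
  assumes "1 \<le> p" "\<xi> \<in> lp_space p"
  shows "lp_norm p \<xi> = 0 \<longleftrightarrow> (\<forall>n. \<xi> n = 0)"
proof -
  have "lp_norm p \<xi> = 0 \<longleftrightarrow> (\<Sum>n. norm (\<xi> n) powr p) = 0"
    by (simp add: lp_norm_def)
  also have "\<dots> \<longleftrightarrow> (\<forall>n. \<xi> n = 0)"
    using assms by (subst suminf_eq_zero_iff) (auto simp: lp_space_def)
  finally show ?thesis .
qed

lemma Minkowski_lp:
  fixes \<xi> \<eta> :: "nat \<Rightarrow> 'e::real_normed_vector"
  assumes p: "1 \<le> p" and x: "\<xi> \<in> lp_space p" and y: "\<eta> \<in> lp_space p"
  shows "(\<lambda>n. \<xi> n + \<eta> n) \<in> lp_space p"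
    and "lp_norm p (\<lambda>n. \<xi> n + \<eta> n) \<le> lp_norm p \<xi> + lp_norm p \<eta>"
proof -
  let ?A = "lp_norm p \<xi>" and ?B = "lp_norm p \<eta>"
  have "(\<lambda>n. \<xi> n + \<eta> n) \<in> lp_space p \<and> lp_norm p (\<lambda>n. \<xi> n + \<eta> n) \<le> ?A + ?B"
  proof (cases "?A = 0 \<or> ?B = 0")
    case True
    then consider "\<xi> = (\<lambda>n. 0)" | "\<eta> = (\<lambda>n. 0)"
      using lp_norm_eq_0_iff[OF p x] lp_norm_eq_0_iff[OF p y] by (auto simp: fun_eq_iff)
    then show ?thesis
      by cases (use x y lp_norm_nonneg[of p] in auto)
  next
    case False
    then have A: "0 < ?A" and B: "0 < ?B"
      using lp_norm_nonneg[of p \<xi>] lp_norm_nonneg[of p \<eta>] by linarith+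
    define S where "S = ?A + ?B"
    define s where "s = ?B / S"
    have S: "0 < S" using A B by (simp add: S_def)
    have s: "0 \<le> s" "s \<le> 1" using A B by (auto simp: s_def S_def)
    have SA: "S * (1 - s) = ?A" and SB: "S * s = ?B" using S by (auto simp: s_def S_def field_simps)
    define g where "g n = S powr p * ((1 - s) * (norm (\<xi> n) powr p / ?A powr p)
      + s * (norm (\<eta> n) powr p / ?B powr p))" for n
    have le: "norm (\<xi> n + \<eta> n) powr p \<le> g n" for n
    proof -
      have "norm (\<xi> n) + norm (\<eta> n) = S * (1 - s) * (norm (\<xi> n) / ?A) + S * s * (norm (\<eta> n) / ?B)"
        unfolding SA SB using A B by simp
      also have "\<dots> = S * ((1 - s) * (norm (\<xi> n) / ?A) + s * (norm (\<eta> n) / ?B))"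
        by (simp add: distrib_left mult.assoc)
      finally have eq: "norm (\<xi> n) + norm (\<eta> n) =
        S * ((1 - s) * (norm (\<xi> n) / ?A) + s * (norm (\<eta> n) / ?B))" .
      have "norm (\<xi> n + \<eta> n) powr p \<le> (norm (\<xi> n) + norm (\<eta> n)) powr p"
        using p by (intro powr_mono2) (auto intro: norm_triangle_ineq)
      also have "\<dots> = S powr p * ((1 - s) * (norm (\<xi> n) / ?A) + s * (norm (\<eta> n) / ?B)) powr p"
        unfolding eq using S s A B by (intro powr_mult)
      also have "\<dots> \<le> S powr p *
          ((1 - s) * (norm (\<xi> n) / ?A) powr p + s * (norm (\<eta> n) / ?B) powr p)"
        using p s A B by (intro mult_left_mono powr_convex_nonneg) auto
      also have "\<dots> = g n" using A B by (simp add: g_def powr_divide)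
      finally show ?thesis .
    qed
    have sx: "(\<lambda>n. norm (\<xi> n) powr p) sums (?A powr p)"
      and sy: "(\<lambda>n. norm (\<eta> n) powr p) sums (?B powr p)"
      using x y lp_norm_powr[OF p x] lp_norm_powr[OF p y] by (auto simp: lp_space_def summable_sums)
    have "g sums (S powr p * ((1 - s) * (?A powr p / ?A powr p) + s * (?B powr p / ?B powr p)))"
      unfolding g_def by (intro sums_mult sums_add sums_divide sx sy)
    then have g: "g sums (S powr p)" using A B by simp
    have summ: "summable (\<lambda>n. norm (\<xi> n + \<eta> n) powr p)"
      using le by (intro summable_comparison_test'[OF sums_summable[OF g]]) auto
    have "(\<Sum>n. norm (\<xi> n + \<eta> n) powr p) \<le> S powr p"
      using suminf_le[OF le summ sums_summable[OF g]] sums_unique[OF g] by simp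
    then have "lp_norm p (\<lambda>n. \<xi> n + \<eta> n) \<le> (S powr p) powr (1 / p)"
      unfolding lp_norm_def using p summ by (intro powr_mono2 suminf_nonneg) auto
    also have "\<dots> = S" using p S by (simp add: powr_powr)
    finally show ?thesis using summ by (simp add: S_def lp_space_def)
  qed
  then show "(\<lambda>n. \<xi> n + \<eta> n) \<in> lp_space p"
    and "lp_norm p (\<lambda>n. \<xi> n + \<eta> n) \<le> ?A + ?B" by auto
qed

lemma lp_space_diff:
  assumes "1 \<le> p" "\<xi> \<in> lp_space p" "\<eta> \<in> lp_space p"
  shows "(\<lambda>n. \<xi> n - \<eta> n) \<in> lp_space p"
proof -
  have "(\<lambda>n. - \<eta> n) \<in> lp_space p" using assms by (simp add: lp_space_def)
  from Minkowski_lp(1)[OF assms(1,2) this] show ?thesis by simp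
qed

lemma Metric_space_lp:
  assumes p: "1 \<le> p"
  shows "Metric_space (lp_space p :: (nat \<Rightarrow> 'e::real_normed_vector) set) (lp_dist p)"
proof
  fix x y z :: "nat \<Rightarrow> 'e"
  show "0 \<le> lp_dist p x y" by (simp add: lp_dist_def lp_norm_nonneg)
  show "lp_dist p x y = lp_dist p y x" by (simp add: lp_dist_def lp_norm_def norm_minus_commute)
  assume x: "x \<in> lp_space p" and y: "y \<in> lp_space p"
  show "lp_dist p x y = 0 \<longleftrightarrow> x = y"
    unfolding lp_dist_def using lp_norm_eq_0_iff[OF p lp_space_diff[OF p x y]]
    by (simp add: fun_eq_iff)
  assume z: "z \<in> lp_space p"
  show "lp_dist p x z \<le> lp_dist p x y + lp_dist p y z"
    unfolding lp_dist_def
    using Minkowski_lp(2)[OF p lp_space_diff[OF p x y] lp_space_diff[OF p y z]] by simp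
qed

lemma mspace_lp_metric [simp]: "1 \<le> p \<Longrightarrow> mspace (lp_metric p) = lp_space p"
  unfolding lp_metric_def by (rule Metric_space.mspace_metric[OF Metric_space_lp])

lemma mdist_lp_metric [simp]: "1 \<le> p \<Longrightarrow> mdist (lp_metric p) = lp_dist p"
  unfolding lp_metric_def by (rule Metric_space.mdist_metric[OF Metric_space_lp])

end

theory Submission
  imports Defs
begin

text \<open>
  Rescaled copies \<open>x \<mapsto> a \<sigma>(c x)\<close> of \<open>\<sigma>\<close> are the coordinates of the required map. Given a radius
  \<open>R\<close>, such a copy can be made to move points at distance at most \<open>R\<close> as little as desired in two
  ways: by taking \<open>c\<close> small, because \<open>\<sigma>\<close> is uniformly continuous, or by taking \<open>a\<close> small, because a
  uniformly continuous map on a normed space is bornologous. The first way keeps a fixed separation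
  of points at large distance, the second, with \<open>c\<close> large, a positive separation of points at small
  distance. If the \<open>n\<close>-th copy moves points at distance at most \<open>n\<close> by at most \<open>(1/2) ^ n\<close>, then
  the copies jointly define a uniformly continuous bornologous map into \<open>\<ell>\<^sup>p(E)\<close>; infinitely many
  copies of the first kind make it expanding and infinitely many of the second kind make it a
  uniform embedding.
\<close>

section \<open>Moduli and powers as real inequalities\<close>

lemma compression_modulus_ge_iff:
  assumes "0 \<le> c"
  shows "ennreal c \<le> compression_modulus m1 m2 f t \<longleftrightarrow>
    (\<forall>a\<in>mspace m1. \<forall>b\<in>mspace m1. t \<le> mdist m1 a b \<longrightarrow> c \<le> mdist m2 (f a) (f b))"
  unfolding compression_modulus_def le_Inf_iff using assms by (fastforce simp: ennreal_le_iff)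

lemma expansion_modulus_le_iff:
  assumes "0 \<le> c"
  shows "expansion_modulus m1 m2 f t \<le> ennreal c \<longleftrightarrow>
    (\<forall>a\<in>mspace m1. \<forall>b\<in>mspace m1. mdist m1 a b \<le> t \<longrightarrow> mdist m2 (f a) (f b) \<le> c)"
  unfolding expansion_modulus_def Sup_le_iff using assms by (fastforce simp: ennreal_le_iff)

lemma powr_mono_base_iff:
  fixes x y p :: real
  assumes "0 < p" "0 \<le> x" "0 \<le> y"
  shows "x powr p \<le> y powr p \<longleftrightarrow> x \<le> y"
proof (cases "x \<le> y")
  case True
  then show ?thesis using assms by (simp add: powr_mono2)
next
  case False
  then have "y powr p < x powr p" using assms by (intro powr_less_mono2) auto
  with False show ?thesis by simp
qed

text \<open>Turns positivity of a modulus, whose value may be \<infinity>, into a real separation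
  constant.\<close>

lemma ennreal_pos_lower_bound:
  fixes x :: ennreal
  assumes "0 < x"
  obtains c :: real where "0 < c" "ennreal c \<le> x"
proof -
  obtain y where y: "0 < y" "y < x" using dense[OF assms] by blast
  then have "y = ennreal (enn2real y)"
    by (metis ennreal_enn2real less_top_ennreal not_less top.not_eq_extremum top_greatest less_trans)
  moreover have "0 < enn2real y" using y calculation
    by (metis ennreal_0 enn2real_nonneg order_le_less less_irrefl)
  ultimately show thesis using that y by (metis less_imp_le)
qed

section \<open>Uniformly continuous maps on normed spaces\<close>

lemma uniformly_continuous_on_UNIV_iff:
  "uniformly_continuous_on UNIV f \<longleftrightarrow>
    (\<forall>e>0. \<exists>d>0. \<forall>x y. dist x y < d \<longrightarrow> dist (f x) (f y) < e)"
  unfolding uniformly_continuous_on_def by blast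

text \<open>Points of a normed space are joined by a segment. Cut into \<open>k\<close> pieces
  shorter than the \<open>d\<close> belonging to tolerance 1, it gives a chain whose image has
  length at most \<open>k\<close>, and \<open>k\<close> depends on \<open>R\<close> only.\<close>

lemma uniformly_continuous_imp_bornologous:
  fixes f :: "'a::real_normed_vector \<Rightarrow> 'b::metric_space"
  assumes "uniformly_continuous_on UNIV f"
  obtains B where "0 \<le> B" "\<And>x y. dist x y \<le> R \<Longrightarrow> dist (f x) (f y) \<le> B"
proof -
  obtain d where d: "0 < d" "\<And>x y. dist x y < d \<Longrightarrow> dist (f x) (f y) < 1"
    using assms zero_less_one unfolding uniformly_continuous_on_UNIV_iff by blast
  have chain: "dist (f x) (f y) \<le> real k" if "dist x y \<le> real k * (d / 2)" for k x y
    using that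
  proof (induction k arbitrary: x)
    case (Suc k)
    define r where "r = 1 / real (Suc k)"
    have r: "0 < r" "r * real (Suc k) = 1" "(1 - r) * real (Suc k) = real k" "r \<le> 1"
      by (auto simp: r_def field_simps)
    \<comment> \<open>\<open>z\<close> is the first of \<open>k + 1\<close> equal division points
      from \<open>x\<close> to \<open>y\<close>. The first piece has length at most
      \<open>d / 2 < d\<close>, and the rest satisfies the induction hypothesis with
      \<open>z\<close> in place of \<open>x\<close>.\<close>
    define z where "z = x + r *\<^sub>R (y - x)"
    have "z - x = r *\<^sub>R (y - x)" "y - z = (1 - r) *\<^sub>R (y - x)"
      by (simp_all add: z_def algebra_simps)
    then have xz: "dist z x = r * dist y x" and zy: "dist y z = (1 - r) * dist y x"
      using r by (simp_all add: dist_norm)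
    have le: "dist y x \<le> real (Suc k) * (d / 2)" using Suc.prems by (simp add: dist_commute)
    have "dist z x \<le> r * (real (Suc k) * (d / 2))"
      unfolding xz using r by (intro mult_left_mono le) simp
    also have "\<dots> = d / 2" using r(2) by (simp flip: mult.assoc)
    finally have "dist x z < d" using d(1) by (simp add: dist_commute)
    then have 1: "dist (f x) (f z) < 1" by (rule d(2))
    have "dist y z \<le> (1 - r) * (real (Suc k) * (d / 2))"
      unfolding zy using r by (intro mult_left_mono le) simp
    also have "\<dots> = real k * (d / 2)" using r(3) by (simp only: flip: mult.assoc)
    finally have "dist z y \<le> real k * (d / 2)" by (simp add: dist_commute)
    then have "dist (f z) (f y) \<le> real k" by (rule Suc.IH)
    with 1 show ?case using dist_triangle[of "f x" "f y" "f z"] by simp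
  qed simp
  obtain k :: nat where "R / (d / 2) < real k" using reals_Archimedean2 by blast
  then have "R \<le> real k * (d / 2)" using d(1) by (simp add: field_simps)
  then show thesis using that[of "real k"] chain by force
qed

section \<open>Contracted and dilated copies of a map\<close>

lemma uniformly_continuous_rescale:
  fixes f :: "'a::real_normed_vector \<Rightarrow> 'b::real_normed_vector"
  assumes "uniformly_continuous_on UNIV f"
  shows "uniformly_continuous_on UNIV (\<lambda>x. a *\<^sub>R f (c *\<^sub>R x))"
proof -
  have "uniformly_continuous_on UNIV (\<lambda>x::'a. c *\<^sub>R x)"
    by (rule bounded_linear.uniformly_continuous_on[OF bounded_linear_scaleR_right
          uniformly_continuous_on_id])
  moreover have "uniformly_continuous_on (range (\<lambda>x. c *\<^sub>R x)) f"
    using assms unfolding uniformly_continuous_on_def by (meson UNIV_I)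
  ultimately have "uniformly_continuous_on UNIV (\<lambda>x. f (c *\<^sub>R x))"
    by (rule uniformly_continuous_on_compose)
  then show ?thesis
    by (rule bounded_linear.uniformly_continuous_on[OF bounded_linear_scaleR_right])
qed

lemma dist_scaleR_right:
  fixes u v :: "'a::real_normed_vector"
  shows "dist (a *\<^sub>R u) (a *\<^sub>R v) = \<bar>a\<bar> * dist u v"
  by (simp add: dist_norm flip: scaleR_diff_right)

text \<open>Shrinking the argument makes the displacement small, while the outer factor
  \<open>1 / \<delta>\<close> normalises the separation to 1. This value is independent of
  \<open>\<epsilon>\<close> and \<open>R\<close>, so the contributions of many copies add up; only
  the threshold \<open>t\<close> depends on them.\<close>

lemma contracted_copy:
  fixes f :: "'a::real_normed_vector \<Rightarrow> 'b::real_normed_vector"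
  assumes uc: "uniformly_continuous_on UNIV f"
    and \<delta>: "0 < \<delta>" "\<forall>x y. \<Delta> \<le> dist x y \<longrightarrow> \<delta> \<le> dist (f x) (f y)"
    and "0 < \<epsilon>" "0 \<le> R"
  shows "\<exists>g :: 'a \<Rightarrow> 'b. uniformly_continuous_on UNIV g \<and>
    (\<forall>x y. dist x y \<le> R \<longrightarrow> dist (g x) (g y) \<le> \<epsilon>) \<and>
    (\<exists>t. \<forall>x y. t \<le> dist x y \<longrightarrow> 1 \<le> dist (g x) (g y))"
proof -
  \<comment> \<open>The tolerance \<open>\<epsilon> * \<delta>\<close> anticipates the outer factor
    \<open>1 / \<delta>\<close>.\<close>
  obtain d where d: "0 < d" "\<And>x y. dist x y < d \<Longrightarrow> dist (f x) (f y) < \<epsilon> * \<delta>"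
    using uc mult_pos_pos[OF \<open>0 < \<epsilon>\<close> \<open>0 < \<delta>\<close>]
    unfolding uniformly_continuous_on_UNIV_iff by blast
  \<comment> \<open>\<open>R + 1\<close> makes \<open>c * R < d\<close> strict and covers
    \<open>R = 0\<close>.\<close>
  define c where "c = d / (R + 1)"
  have c: "0 < c" "c * R < d" using d(1) \<open>0 \<le> R\<close> by (auto simp: c_def field_simps)
  define g where "g x = (1 / \<delta>) *\<^sub>R f (c *\<^sub>R x)" for x
  have dist_g: "dist (g x) (g y) = dist (f (c *\<^sub>R x)) (f (c *\<^sub>R y)) / \<delta>" for x y
    unfolding g_def dist_scaleR_right using \<delta>(1) by simp
  show ?thesis
  proof (intro exI[of _ g] conjI exI[of _ "\<Delta> / c"] allI impI)
    show "uniformly_continuous_on UNIV g"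
      unfolding g_def by (rule uniformly_continuous_rescale[OF uc])
    fix x y :: 'a
    show "dist (g x) (g y) \<le> \<epsilon>" if "dist x y \<le> R"
    proof -
      have "c * dist x y \<le> c * R" using that c(1) by simp
      also note c(2)
      finally have "dist (f (c *\<^sub>R x)) (f (c *\<^sub>R y)) < \<epsilon> * \<delta>"
        using c(1) by (intro d(2)) (simp add: dist_scaleR_right)
      then show ?thesis using \<delta>(1) by (simp add: dist_g field_simps)
    qed
    show "1 \<le> dist (g x) (g y)" if "\<Delta> / c \<le> dist x y"
    proof -
      have "\<Delta> \<le> dist (c *\<^sub>R x) (c *\<^sub>R y)" using that c by (simp add: dist_scaleR_right field_simps)
      from \<delta>(2)[rule_format, OF this] show ?thesis using \<delta>(1) by (simp add: dist_g)
    qed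
  qed
qed

text \<open>Here the threshold \<open>\<Delta> / c\<close> is prescribed through the dilation
  factor, and the separation \<open>s\<close> pays for it: the displacement at distance at most
  \<open>R\<close> is bounded because \<open>f\<close> is bornologous, and a small outer factor
  brings it below \<open>\<epsilon>\<close>.\<close>

lemma dilated_copy:
  fixes f :: "'a::real_normed_vector \<Rightarrow> 'b::real_normed_vector"
  assumes uc: "uniformly_continuous_on UNIV f"
    and \<delta>: "0 < \<delta>" "\<forall>x y. \<Delta> \<le> dist x y \<longrightarrow> \<delta> \<le> dist (f x) (f y)"
    and "0 < \<epsilon>" "0 < c"
  shows "\<exists>g :: 'a \<Rightarrow> 'b. uniformly_continuous_on UNIV g \<and>
    (\<forall>x y. dist x y \<le> R \<longrightarrow> dist (g x) (g y) \<le> \<epsilon>) \<and>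
    (\<exists>s>0. \<forall>x y. \<Delta> / c \<le> dist x y \<longrightarrow> s \<le> dist (g x) (g y))"
proof -
  obtain B where B: "0 \<le> B" "\<And>x y. dist x y \<le> c * R \<Longrightarrow> dist (f x) (f y) \<le> B"
    using uniformly_continuous_imp_bornologous[OF uc] by blast
  define a where "a = \<epsilon> / (B + 1)"
  have a: "0 < a" "a * B \<le> \<epsilon>" using B(1) \<open>0 < \<epsilon>\<close> by (auto simp: a_def field_simps)
  define g where "g x = a *\<^sub>R f (c *\<^sub>R x)" for x
  have dist_g: "dist (g x) (g y) = a * dist (f (c *\<^sub>R x)) (f (c *\<^sub>R y))" for x y
    unfolding g_def dist_scaleR_right using a(1) by simp
  show ?thesis
  proof (intro exI[of _ g] conjI exI[of _ "a * \<delta>"] allI impI)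
    show "uniformly_continuous_on UNIV g"
      unfolding g_def by (rule uniformly_continuous_rescale[OF uc])
    show "0 < a * \<delta>" using a \<delta> by simp
    fix x y :: 'a
    show "dist (g x) (g y) \<le> \<epsilon>" if "dist x y \<le> R"
    proof -
      have "dist (f (c *\<^sub>R x)) (f (c *\<^sub>R y)) \<le> B"
        using that \<open>0 < c\<close> by (intro B(2)) (simp add: dist_scaleR_right)
      then have "dist (g x) (g y) \<le> a * B" using a(1) by (simp add: dist_g)
      with a(2) show ?thesis by simp
    qed
    show "a * \<delta> \<le> dist (g x) (g y)" if "\<Delta> / c \<le> dist x y"
    proof -
      have "\<Delta> \<le> dist (c *\<^sub>R x) (c *\<^sub>R y)" using that \<open>0 < c\<close> by (simp add: dist_scaleR_right field_simps)
      from \<delta>(2)[rule_format, OF this] show ?thesis using a(1) by (simp add: dist_g)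
    qed
  qed
qed

section \<open>Gluing a sequence of maps into a map to the sequence space\<close>

locale locally_summable_maps =
  fixes f :: "nat \<Rightarrow> 'a::real_normed_vector \<Rightarrow> 'b::real_normed_vector" and p :: real
  assumes p: "1 \<le> p"
    and uc: "\<And>n. uniformly_continuous_on UNIV (f n)"
    and small: "\<And>n x y. dist x y \<le> real n \<Longrightarrow> dist (f n x) (f n y) \<le> (1/2) ^ n"
begin

text \<open>Subtracting the value at 0 makes each image sequence p-summable, and it cancels in
  differences, so distances involve the \<open>f n\<close> alone.\<close>

definition glue :: "'a \<Rightarrow> nat \<Rightarrow> 'b" where
  "glue x = (\<lambda>n. f n x - f n 0)"

text \<open>Raising a number in [0, 1] to a power \<open>p\<close> \<ge> 1 does not increase it, so
  the tail bound is the same for all \<open>p\<close>.\<close>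

lemma tail_le:
  assumes "dist x y \<le> real N" "N \<le> n"
  shows "dist (f n x) (f n y) powr p \<le> (1/2) ^ n"
proof -
  have "dist (f n x) (f n y) powr p \<le> ((1/2) ^ n) powr p"
    using p assms by (intro powr_mono2 small) auto
  also have "\<dots> \<le> ((1/2) ^ n) powr 1"
    using p by (intro powr_mono') (auto intro: power_le_one)
  finally show ?thesis by simp
qed

lemma summable_dist: "summable (\<lambda>n. dist (f n x) (f n y) powr p)"
proof -
  obtain N :: nat where "dist x y \<le> real N" using real_arch_simple by blast
  then have bound: "norm (dist (f n x) (f n y) powr p) \<le> (1/2) ^ n" if "N \<le> n" for n
    using tail_le that by simp
  show ?thesis
    by (rule summable_comparison_test'[OF summable_geometric bound]) auto
qed

lemma glue_in_lp_space: "glue x \<in> lp_space p"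
  using summable_dist[of x 0] by (simp add: glue_def lp_space_def dist_norm)

lemma lp_dist_glue_powr:
  "lp_dist p (glue x) (glue y) powr p = (\<Sum>n. dist (f n x) (f n y) powr p)"
  unfolding lp_dist_def
  by (subst lp_norm_powr[OF p lp_space_diff[OF p glue_in_lp_space glue_in_lp_space]])
    (simp add: glue_def dist_norm)

lemma lp_dist_glue_nonneg: "0 \<le> lp_dist p (glue x) (glue y)"
  by (simp add: lp_dist_def lp_norm_nonneg)

text \<open>From index \<open>N\<close> on the terms are dominated by a geometric series, uniformly
  in the two points. This leaves finitely many coordinates, which can be controlled one at a
  time.\<close>

lemma lp_dist_glue_upper:
  assumes "dist x y \<le> real N"
  shows "lp_dist p (glue x) (glue y) powr p
    \<le> (\<Sum>n<N. dist (f n x) (f n y) powr p) + 2 * (1/2) ^ N"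
proof -
  have geo: "(\<lambda>n. (1/2::real) ^ (n + N)) sums (2 * (1/2) ^ N)"
    using sums_mult2[OF geometric_sums[of "1/2::real"], of "(1/2) ^ N"] by (simp add: power_add)
  have "(\<Sum>n. dist (f (n + N) x) (f (n + N) y) powr p) \<le> (\<Sum>n. (1/2::real) ^ (n + N))"
    using tail_le[OF assms] sums_summable[OF geo] summable_dist
    by (intro suminf_le summable_ignore_initial_segment) auto
  also have "\<dots> = 2 * (1/2) ^ N" using sums_unique[OF geo] by simp
  finally show ?thesis
    unfolding lp_dist_glue_powr suminf_split_initial_segment[OF summable_dist, of x y N] by simp
qed

lemma lp_dist_glue_lower:
  assumes "finite I"
  shows "(\<Sum>n\<in>I. dist (f n x) (f n y) powr p) \<le> lp_dist p (glue x) (glue y) powr p"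
  unfolding lp_dist_glue_powr by (intro sum_le_suminf summable_dist assms) auto

lemma coordinate_le_lp_dist_glue: "dist (f n x) (f n y) \<le> lp_dist p (glue x) (glue y)"
  using lp_dist_glue_lower[of "{n}" x y] p lp_dist_glue_nonneg by (simp add: powr_mono_base_iff)

lemma bornologous_glue: "bornologous euclidean_metric (lp_metric p) glue"
  unfolding bornologous_def
proof (intro conjI allI)
  show "glue \<in> mspace euclidean_metric \<rightarrow> mspace (lp_metric p)"
    using p glue_in_lp_space by simp
  fix t :: real
  obtain N :: nat where N: "t \<le> real N" using real_arch_simple by blast
  \<comment> \<open>These bounds vary with \<open>n\<close> without any uniformity; only those with
    \<open>n < N\<close> enter \<open>C\<close>.\<close>
  have "\<exists>B\<ge>0. \<forall>x y. dist x y \<le> t \<longrightarrow> dist (f n x) (f n y) \<le> B" for n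
    using uniformly_continuous_imp_bornologous[OF uc] by metis
  then obtain B where B: "\<And>n. 0 \<le> B n" "\<And>n x y. dist x y \<le> t \<Longrightarrow> dist (f n x) (f n y) \<le> B n"
    by metis
  define C where "C = (\<Sum>n<N. B n powr p) + 2 * (1/2) ^ N"
  have C: "0 \<le> C" by (auto simp: C_def intro!: add_nonneg_nonneg sum_nonneg)
  have "lp_dist p (glue x) (glue y) \<le> C powr (1 / p)" if xy: "dist x y \<le> t" for x y
  proof -
    have "lp_dist p (glue x) (glue y) powr p
        \<le> (\<Sum>n<N. dist (f n x) (f n y) powr p) + 2 * (1/2) ^ N"
      using xy N by (intro lp_dist_glue_upper) simp
    also have "\<dots> \<le> C"
      unfolding C_def using p B xy by (intro add_right_mono sum_mono powr_mono2) auto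
    also have "C = (C powr (1 / p)) powr p" using p C by (simp add: powr_powr)
    finally show ?thesis
      by (rule powr_mono_base_iff[THEN iffD1, rotated 3]) (use p lp_dist_glue_nonneg in auto)
  qed
  then have "expansion_modulus euclidean_metric (lp_metric p) glue t \<le> ennreal (C powr (1 / p))"
    using p by (subst expansion_modulus_le_iff) auto
  then show "expansion_modulus euclidean_metric (lp_metric p) glue t < \<infinity>"
    by (simp add: order_le_less_trans)
qed

lemma uniformly_continuous_glue: "uniformly_continuous_map euclidean_metric (lp_metric p) glue"
  unfolding uniformly_continuous_map_def
proof (intro conjI allI impI)
  show "glue \<in> mspace euclidean_metric \<rightarrow> mspace (lp_metric p)"
    using p glue_in_lp_space by simp
  fix e :: real assume e: "0 < e"
  have "(\<lambda>N. 2 * (1/2::real) ^ N) \<longlonglongrightarrow> 0"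
    by (intro tendsto_mult_right_zero LIMSEQ_realpow_zero) auto
  then have "\<forall>\<^sub>F N in sequentially. 2 * (1/2::real) ^ N < e powr p / 2"
    by (rule order_tendstoD(2)) (use e in simp)
  \<comment> \<open>\<open>1 \<le> N\<close> ensures that points at distance below 1 satisfy the
    hypothesis \<open>dist x y \<le> real N\<close> of the tail estimate.\<close>
  then have "\<forall>\<^sub>F N in sequentially. 2 * (1/2::real) ^ N < e powr p / 2 \<and> 1 \<le> N"
    using eventually_ge_at_top by (rule eventually_conj)
  then obtain N where N: "2 * (1/2::real) ^ N < e powr p / 2" "1 \<le> N"
    by (auto simp: eventually_sequentially)
  \<comment> \<open>Stating uniform continuity as a limit along \<open>uniformity\<close> lets the
    limit rules for powers and finite sums yield one \<open>d\<close> for the whole head.\<close>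
  have "((\<lambda>z. dist (f n (fst z)) (f n (snd z))) \<longlongrightarrow> 0) uniformity" for n
  proof (rule order_tendstoI)
    fix r :: real
    show "\<forall>\<^sub>F z in uniformity. r < dist (f n (fst z)) (f n (snd z))" if "r < 0"
      using that by (intro always_eventually) (auto intro: less_le_trans)
    show "\<forall>\<^sub>F z in uniformity. dist (f n (fst z)) (f n (snd z)) < r" if r: "0 < r"
    proof -
      obtain d where "0 < d" "\<And>x y. dist x y < d \<Longrightarrow> dist (f n x) (f n y) < r"
        using uc[of n] r unfolding uniformly_continuous_on_UNIV_iff by blast
      then show ?thesis unfolding eventually_uniformity_metric by auto
    qed
  qed
  then have "((\<lambda>z. \<Sum>n<N. dist (f n (fst z)) (f n (snd z)) powr p) \<longlongrightarrow> (\<Sum>n<N. 0)) uniformity"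
    using p by (intro tendsto_sum tendsto_zero_powrI[where b = p]) auto
  then have "\<forall>\<^sub>F z in uniformity. (\<Sum>n<N. dist (f n (fst z)) (f n (snd z)) powr p) < e powr p / 2"
    using e by (intro order_tendstoD(2)) auto
  then obtain d where d: "0 < d"
    "\<And>x y. dist x y < d \<Longrightarrow> (\<Sum>n<N. dist (f n x) (f n y) powr p) < e powr p / 2"
    unfolding eventually_uniformity_metric by auto
  have "lp_dist p (glue x) (glue y) < e" if "dist x y < min d 1" for x y
  proof -
    have "lp_dist p (glue x) (glue y) powr p < e powr p"
      using lp_dist_glue_upper[of x y N] d(2)[of x y] that N by simp
    then show ?thesis using e p lp_dist_glue_nonneg by (simp add: powr_mono_base_iff flip: not_le)
  qed
  then show "\<exists>\<delta>>0. \<forall>x\<in>mspace euclidean_metric. \<forall>y\<in>mspace euclidean_metric.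
      mdist euclidean_metric y x < \<delta> \<longrightarrow> mdist (lp_metric p) (glue y) (glue x) < e"
    using d(1) p by (intro exI[of _ "min d 1"]) auto
qed

text \<open>A single separating coordinate bounds the distance in the sequence space from below, and
  its index may depend on \<open>t\<close>.\<close>

lemma uniform_embedding_glue:
  assumes "\<And>t. 0 < t \<Longrightarrow> \<exists>n. \<exists>s>0. \<forall>x y. t \<le> dist x y \<longrightarrow> s \<le> dist (f n x) (f n y)"
  shows "uniform_embedding euclidean_metric (lp_metric p) glue"
  unfolding uniform_embedding_def
proof (intro conjI allI impI uniformly_continuous_glue)
  fix t :: real assume "0 < t"
  then obtain n s where s: "0 < s" "\<And>x y. t \<le> dist x y \<Longrightarrow> s \<le> dist (f n x) (f n y)"
    using assms by metis
  have "s \<le> lp_dist p (glue x) (glue y)" if "t \<le> dist x y" for x y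
    using s(2)[OF that] coordinate_le_lp_dist_glue by (rule order_trans)
  then have "ennreal s \<le> compression_modulus euclidean_metric (lp_metric p) glue t"
    using p s(1) by (simp add: compression_modulus_ge_iff)
  then show "0 < compression_modulus euclidean_metric (lp_metric p) glue t"
    using s(1) by (metis ennreal_less_zero_iff less_le_trans)
qed

text \<open>\<open>N\<close> coordinates that each separate by at least 1 contribute at least
  \<open>N\<close> to the p-th power of the distance, and \<open>N\<close> is arbitrary.\<close>

lemma expanding_glue:
  assumes "infinite {n. \<exists>t. \<forall>x y. t \<le> dist x y \<longrightarrow> 1 \<le> dist (f n x) (f n y)}" (is "infinite ?I")
  shows "expanding euclidean_metric (lp_metric p) glue"
  unfolding expanding_def infinity_ennreal_def tendsto_top_iff_ennreal
proof (intro conjI allI impI)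
  show "glue \<in> mspace euclidean_metric \<rightarrow> mspace (lp_metric p)"
    using p glue_in_lp_space by simp
  fix l :: real assume l: "0 \<le> l"
  \<comment> \<open>Aiming at \<open>l + 1\<close> leaves room for the strict inequality
    \<open>ennreal l < ...\<close>, since pointwise bounds pass to the infimum only as weak
    ones.\<close>
  obtain N :: nat where N: "(l + 1) powr p < real N" using reals_Archimedean2 by blast
  obtain F where F: "finite F" "card F = N" "F \<subseteq> ?I"
    using infinite_arbitrarily_large[OF assms] by blast
  then have "\<forall>n\<in>F. \<exists>t. \<forall>x y. t \<le> dist x y \<longrightarrow> 1 \<le> dist (f n x) (f n y)" by blast
  then obtain t where t: "\<And>n x y. n \<in> F \<Longrightarrow> t n \<le> dist x y \<Longrightarrow> 1 \<le> dist (f n x) (f n y)"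
    by metis
  \<comment> \<open>The sum of absolute values dominates every threshold \<open>t n\<close> with
    \<open>n \<in> F\<close>.\<close>
  define T where "T = (\<Sum>n\<in>F. \<bar>t n\<bar>)"
  have T: "t n \<le> T" if "n \<in> F" for n
    using member_le_sum[OF that, of "\<lambda>n. \<bar>t n\<bar>"] F(1) by (simp add: T_def)
  have "l + 1 \<le> lp_dist p (glue x) (glue y)" if xy: "T \<le> dist x y" for x y
  proof -
    have "real N = (\<Sum>n\<in>F. 1)" using F by simp
    also have "\<dots> \<le> (\<Sum>n\<in>F. dist (f n x) (f n y) powr p)"
      using t T xy p by (intro sum_mono ge_one_powr_ge_zero) force+
    also have "\<dots> \<le> lp_dist p (glue x) (glue y) powr p" by (rule lp_dist_glue_lower[OF F(1)])
    finally have "(l + 1) powr p \<le> lp_dist p (glue x) (glue y) powr p" using N by simp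
    then show ?thesis using p l lp_dist_glue_nonneg by (simp add: powr_mono_base_iff)
  qed
  then have "ennreal (l + 1) \<le> compression_modulus euclidean_metric (lp_metric p) glue t'"
    if "T \<le> t'" for t'
    using that p l by (subst compression_modulus_ge_iff) auto
  moreover have "ennreal l < ennreal (l + 1)" using l by (simp add: ennreal_less_iff)
  ultimately have "\<forall>t'\<ge>T. ennreal l < compression_modulus euclidean_metric (lp_metric p) glue t'"
    using less_le_trans by blast
  then show "\<forall>\<^sub>F t' in at_top. ennreal l < compression_modulus euclidean_metric (lp_metric p) glue t'"
    unfolding eventually_at_top_linorder by blast
qed

end

section \<open>Interleaving the two kinds of copies\<close>

theorem theorem2:
  fixes \<sigma> :: "'x::banach \<Rightarrow> 'e::banach" and p :: real
  assumes "uniformly_continuous_map euclidean_metric euclidean_metric \<sigma>"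
    and "uncollapsed euclidean_metric euclidean_metric \<sigma>"
    and "1 \<le> p"
  shows "\<exists>\<phi> :: 'x \<Rightarrow> nat \<Rightarrow> 'e.
    uniform_embedding euclidean_metric (lp_metric p) \<phi> \<and>
    coarse_embedding euclidean_metric (lp_metric p) \<phi>"
proof -
  have uc: "uniformly_continuous_on UNIV \<sigma>"
    using assms(1) by (simp add: uniformly_continuous_map_def uniformly_continuous_on_def)
  obtain \<Delta> where \<Delta>: "0 < \<Delta>" "0 < compression_modulus euclidean_metric euclidean_metric \<sigma> \<Delta>"
    using assms(2) unfolding uncollapsed_def by blast
  then obtain \<delta> where "0 < \<delta>"
    "ennreal \<delta> \<le> compression_modulus euclidean_metric euclidean_metric \<sigma> \<Delta>"
    using ennreal_pos_lower_bound by blast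
  then have \<delta>: "0 < \<delta>" "\<forall>x y. \<Delta> \<le> dist x y \<longrightarrow> \<delta> \<le> dist (\<sigma> x) (\<sigma> y)"
    by (auto simp: compression_modulus_ge_iff)
  \<comment> \<open>Even indices carry contracted copies, odd ones copies dilated by
    \<open>n\<close> itself, so that the thresholds \<open>\<Delta> / real n\<close> tend to 0.
    Oddness also keeps \<open>n\<close> positive.\<close>
  define good where "good n g \<longleftrightarrow> uniformly_continuous_on UNIV g \<and>
      (\<forall>x y. dist x y \<le> real n \<longrightarrow> dist (g x) (g y) \<le> (1/2) ^ n) \<and>
      (even n \<longrightarrow> (\<exists>t. \<forall>x y. t \<le> dist x y \<longrightarrow> 1 \<le> dist (g x) (g y))) \<and>
      (odd n \<longrightarrow> (\<exists>s>0. \<forall>x y. \<Delta> / real n \<le> dist x y \<longrightarrow> s \<le> dist (g x) (g y)))"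
    for n and g :: "'x \<Rightarrow> 'e"
  have "\<exists>g. good n g" for n
  proof (cases "even n")
    case True
    then show ?thesis
      using contracted_copy[OF uc \<delta>, of "(1/2) ^ n" "real n"] unfolding good_def by simp
  next
    case False
    then have n: "0 < real n" by (cases n) auto
    with False show ?thesis
      using dilated_copy[OF uc \<delta>, of "(1/2) ^ n" "real n" "real n"] unfolding good_def by simp
  qed
  then obtain f where "\<And>n. good n (f n)" by metis
  then have f: "\<And>n. uniformly_continuous_on UNIV (f n)"
    "\<And>n x y. dist x y \<le> real n \<Longrightarrow> dist (f n x) (f n y) \<le> (1/2) ^ n"
    "\<And>n. even n \<Longrightarrow> \<exists>t. \<forall>x y. t \<le> dist x y \<longrightarrow> 1 \<le> dist (f n x) (f n y)"
    "\<And>n. odd n \<Longrightarrow> \<exists>s>0. \<forall>x y. \<Delta> / real n \<le> dist x y \<longrightarrow> s \<le> dist (f n x) (f n y)"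
    unfolding good_def by auto
  interpret locally_summable_maps f p
    by unfold_locales (use assms(3) f in auto)
  have "\<exists>n. \<exists>s>0. \<forall>x y. t \<le> dist x y \<longrightarrow> s \<le> dist (f n x) (f n y)" if t: "0 < t" for t
  proof -
    \<comment> \<open>An odd index beyond \<open>\<Delta> / t\<close> has its threshold below
      \<open>t\<close>.\<close>
    obtain k :: nat where "\<Delta> / t < real k" using reals_Archimedean2 by blast
    then have "\<Delta> / t < real (2 * k + 1)" by simp
    then have "\<Delta> / real (2 * k + 1) \<le> t" using t
      by (simp add: divide_less_eq divide_le_eq mult.commute)
    moreover have "odd (2 * k + 1)" by simp
    from f(4)[OF this] obtain s where "0 < s"
      "\<forall>x y. \<Delta> / real (2 * k + 1) \<le> dist x y \<longrightarrow> s \<le> dist (f (2 * k + 1) x) (f (2 * k + 1) y)"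
      by blast
    ultimately show ?thesis by (meson order_trans)
  qed
  then have "uniform_embedding euclidean_metric (lp_metric p) glue"
    by (rule uniform_embedding_glue)
  moreover have "expanding euclidean_metric (lp_metric p) glue"
  proof (rule expanding_glue, rule infinite_super)
    show "range (\<lambda>k::nat. 2 * k) \<subseteq> {n. \<exists>t. \<forall>x y. t \<le> dist x y \<longrightarrow> 1 \<le> dist (f n x) (f n y)}"
      using f(3) by auto
    show "infinite (range (\<lambda>k::nat. 2 * k))" by (intro range_inj_infinite injI) simp
  qed
  ultimately show ?thesis
    using bornologous_glue unfolding coarse_embedding_def by blast
qed

end
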